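(* Let $n\ge 2$, let $M,k\ge 1$ be odd integers all of whose prime divisors are congruent to $1$ modulo $4$, and let $U,D\ge 0$ be integers. Put $\epsilon_j=(n-j)(n-j-2)$. Let $a_{ij}\in\mathbb{Z}$ ($1\le i\le 3$, $1\le j\le n+1$) satisfy $a_{1j}=a_{2j}=a_{3j}$ for every $j$. Let $S: Ax=b$, with $A\in M_{3\times(n+1)}(\mathbb{Z})$, be the system of three linear equations in the unknowns $c_1,\dots,c_{n+1}$ given by $$\sum_{j=0}^{n-3}(-1)^{n-j-2}a_{1,j+1}\epsilon_j c_{j+1}+a_{1n}c_n=4U-1,$$ $$\sum_{j=0}^{n-1}(-1)^{n-j+1}a_{2,j+1}c_{j+1}=4D-1,$$ $$\sum_{j=0}^{n}(-1)^{n-j+1}a_{3,j+1}c_{j+1}=Mk^2 .$$ Let $\{s_1,s_2,\dots,s_N\}\subset\mathbb{Z}^{n+1}$ be the set of integer solutions of $S$. For each solution $s_i=(c_1,c_2,\dots,c_{n+1})$ let $$C_{s_i}: My^2 = a_{31}c_1 x^n + a_{32}c_2 x^{n-1} + a_{33}c_3 x^{n-2} + \cdots + a_{3,n+1}c_{n+1},$$ and suppose that $C_{s_i}$ is a nonsingular plane algebraic curve of genus $g\ge 0$ and degree $n$. If, for each $i$, $x>1$ and $y\ge 1$ hold for all $(x,y)\in C_{s_i}(\mathbb{Z}^+)$, then $C_{s_i}(\mathbb{Z}^+)=\emptyset$ for every $i=1,\dots,N$.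
   Context: $C(\mathbb{Z}^+)$ denotes the set of pairs $(x,y)$ of positive integers satisfying the equation of the curve $C$. Empty sums are $0$. The condition on prime divisors is vacuous for the integer $1$. *)

theory Defs
  imports "HOL-Analysis.Analysis" "HOL-Computational_Algebra.Polynomial"
    "HOL-Library.Disjoint_Sets" "HOL-Number_Theory.Cong"
begin

section \<open>Plane algebraic curves\<close>

text \<open>
  A polynomial in \<open>\<int>[x][y]\<close> is an \<open>int poly poly\<close>: the outer variable is \<open>y\<close>, the inner one \<open>x\<close>.
  The curve is the affine plane curve \<open>F(x,y) = 0\<close>.
\<close>

definition eval2 :: "'a::comm_semiring_1 poly poly \<Rightarrow> 'a \<Rightarrow> 'a \<Rightarrow> 'a" where
  "eval2 F x y = poly (poly F [:y:]) x"

definition total_degree :: "'a::zero poly poly \<Rightarrow> nat" where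
  "total_degree F = Max ((\<lambda>i. i + degree (coeff F i)) ` {i. coeff F i \<noteq> 0})"

definition complexify :: "int poly poly \<Rightarrow> complex poly poly" where
  "complexify F = map_poly (map_poly of_int) F"

definition complex_points :: "int poly poly \<Rightarrow> (complex \<times> complex) set" where
  "complex_points F = {(x, y). eval2 (complexify F) x y = 0}"

definition positive_points :: "int poly poly \<Rightarrow> (int \<times> int) set" where
  "positive_points F = {(x, y). x > 0 \<and> y > 0 \<and> eval2 F x y = 0}"

text \<open>
  Nonsingularity is that of the affine curve, over the complex numbers: \<open>map_poly pderiv\<close> is the
  partial derivative in \<open>x\<close>, \<open>pderiv\<close> the one in \<open>y\<close>. (The projective closure of
  \<open>M y\<^sup>2 = f(x)\<close> is always singular at infinity when \<open>deg f \<ge> 4\<close>.)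
\<close>

definition nonsingular :: "int poly poly \<Rightarrow> bool" where
  "nonsingular F \<longleftrightarrow>
     (\<forall>(x, y) \<in> complex_points F.
        eval2 (map_poly pderiv (complexify F)) x y \<noteq> 0 \<or>
        eval2 (pderiv (complexify F)) x y \<noteq> 0)"

text \<open>
  The genus of a connected orientable surface is the maximal number of pairwise disjoint simple
  closed curves whose joint removal leaves the surface connected. The complex points of a nonsingular
  irreducible affine curve form such a surface. It is its smooth projective model with finitely many
  points removed; removing these points does not affect which systems of curves disconnect, so this is
  also the (geometric) genus of the smooth projective model.
\<close>

definition nonseparating_system :: "'a::topological_space set \<Rightarrow> 'a set set \<Rightarrow> bool" where
  "nonseparating_system X \<C> \<longleftrightarrow>
     finite \<C> \<and> disjoint \<C> \<and>
     (\<forall>K\<in>\<C>. K \<subseteq> X \<and> (\<exists>\<gamma>. simple_path \<gamma> \<and> pathfinish \<gamma> = pathstart \<gamma> \<and> path_image \<gamma> = K)) \<and>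
     connected (X - \<Union>\<C>)"

definition surface_genus :: "'a::topological_space set \<Rightarrow> nat \<Rightarrow> bool" where
  "surface_genus X g \<longleftrightarrow>
     connected X \<and>
     (\<exists>\<C>. nonseparating_system X \<C> \<and> card \<C> = g) \<and>
     (\<forall>\<C>. nonseparating_system X \<C> \<longrightarrow> card \<C> \<le> g)"

definition nonsingular_plane_curve :: "int poly poly \<Rightarrow> nat \<Rightarrow> nat \<Rightarrow> bool" where
  "nonsingular_plane_curve F g d \<longleftrightarrow>
     nonsingular F \<and> surface_genus (complex_points F) g \<and> total_degree F = d"


section \<open>The linear system and the curves attached to its solutions\<close>

definition eps :: "nat \<Rightarrow> nat \<Rightarrow> int" where
  "eps n j = (int n - int j) * (int n - int j - 2)"

text \<open>
  Vectors in \<open>\<int>\<^sup>n\<^sup>+\<^sup>1\<close> are functions on \<open>{1..n+1}\<close>, extended by \<open>undefined\<close>. The range \<open>j < n - 2\<close> is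
  \<open>0 \<le> j \<le> n - 3\<close>, which is empty for \<open>n = 2\<close>.
\<close>

definition solutions ::
  "nat \<Rightarrow> int \<Rightarrow> int \<Rightarrow> int \<Rightarrow> int \<Rightarrow> (nat \<Rightarrow> nat \<Rightarrow> int) \<Rightarrow> (nat \<Rightarrow> int) set" where
  "solutions n M k U D a =
     {c \<in> {1..n+1} \<rightarrow>\<^sub>E UNIV.
        (\<Sum>j<n-2. (-1) ^ (n-j-2) * a 1 (j+1) * eps n j * c (j+1)) + a 1 n * c n = 4 * U - 1 \<and>
        (\<Sum>j=0..n-1. (-1) ^ (n-j+1) * a 2 (j+1) * c (j+1)) = 4 * D - 1 \<and>
        (\<Sum>j=0..n. (-1) ^ (n-j+1) * a 3 (j+1) * c (j+1)) = M * k ^ 2}"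

definition curve :: "nat \<Rightarrow> int \<Rightarrow> (nat \<Rightarrow> nat \<Rightarrow> int) \<Rightarrow> (nat \<Rightarrow> int) \<Rightarrow> int poly poly" where
  "curve n M a c = [: - (\<Sum>j=0..n. monom (a 3 (j+1) * c (j+1)) (n-j)), 0, [:M:] :]"

lemma eval2_curve:
  "eval2 (curve n M a c) x y = 0 \<longleftrightarrow>
     M * y ^ 2 = (\<Sum>j=0..n. a 3 (j+1) * c (j+1) * x ^ (n-j))"
  by (auto simp: eval2_def curve_def poly_sum poly_monom power2_eq_square algebra_simps)

end

theory Submission
  imports Defs "HOL-Number_Theory.Residues"
begin

text \<open>
  Write \<open>f(x)\<close> for the right-hand side of the curve, so that \<open>f\<^sub>i\<close>, the coefficient of \<open>x\<^sup>i\<close>, is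
  \<open>a\<^sub>3\<^sub>j c\<^sub>j\<close> with \<open>j = n - i + 1\<close>. As the three rows of \<open>a\<close> agree, the linear system is a system of
  conditions on \<open>f\<close>. The third equation says that \<open>f(-1) = -M k\<^sup>2\<close>, and the second one that
  \<open>f(0) - f(-1) = 4D - 1\<close>; since \<open>M k\<^sup>2\<close> is \<open>1\<close> modulo \<open>4\<close>,
  it follows that \<open>f(0)\<close> is \<open>2\<close> modulo \<open>4\<close>. The first equation says that \<open>f''(-1) + f'(-1) = 4U - 1\<close>, because the coefficient
  of \<open>f\<^sub>i\<close> in it is \<open>(-1)\<^sup>i i (i - 2)\<close>. This coefficient is \<open>1\<close> modulo \<open>4\<close> for odd \<open>i\<close> and
  \<open>0\<close> modulo \<open>4\<close> for even \<open>i\<close>; hence the sum of the odd coefficients, which is \<open>(f(1) - f(-1)) / 2\<close>, is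
  \<open>3\<close> modulo \<open>4\<close>.

  At a point \<open>(x, y)\<close> of the curve, \<open>M (y\<^sup>2 + k\<^sup>2) = f(x) - f(-1) = (x + 1) h(x)\<close> for some integer
  polynomial \<open>h\<close>. A prime that is \<open>3\<close> modulo \<open>4\<close> divides a sum of two squares only if it divides both
  terms, and it divides neither \<open>M\<close> nor \<open>k\<close>. So every positive odd divisor of
  \<open>M (y\<^sup>2 + k\<^sup>2)\<close> is \<open>1\<close> modulo \<open>4\<close> (lemma \<open>odd_divisor_cong_1_mod_4\<close>). Two of its divisors
  contradict this, according to the parity of \<open>x > 0\<close> (lemma \<open>no_point_if_congruences\<close>).

  \<^item> If \<open>x\<close> is even, then \<open>x + 1\<close> is odd, so \<open>4\<close> divides \<open>x\<close> and \<open>M y\<^sup>2 = f(x)\<close> is congruent to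
    \<open>f(0)\<close>, hence to \<open>2\<close> modulo \<open>4\<close>, which is impossible for an odd multiple of a square.
  \<^item> If \<open>x\<close> is odd, then so is \<open>y\<close>, and \<open>M (y\<^sup>2 + k\<^sup>2)\<close> is \<open>2\<close> modulo \<open>4\<close>. So \<open>(x + 1) / 2\<close> and
    \<open>h(x)\<close> are odd divisors. The first one being odd gives \<open>x = 1\<close> modulo \<open>4\<close>, so that \<open>h(x)\<close> is congruent to
    \<open>h(1) = (f(1) - f(-1)) / 2\<close>, that is, to \<open>3\<close> modulo \<open>4\<close>.
\<close>

section \<open>Divisors of sums of two squares\<close>

lemma fermat_theorem_int:
  fixes p a :: int
  assumes "prime p" and "\<not> p dvd a"
  shows "[a ^ (nat p - 1) = 1] (mod p)"
proof -
  have p: "p > 0" using assms(1) by (simp add: prime_gt_0_int)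
  define b where "b = nat (a mod p)"
  have b: "int b = a mod p" using p by (simp add: b_def)
  have "\<not> p dvd int b" using assms(2) by (simp add: b dvd_mod_iff)
  hence "\<not> nat p dvd b" using p by (simp add: nat_dvd_iff)
  hence "[b ^ (nat p - 1) = 1] (mod nat p)"
    using assms(1) prime_int_nat_transfer by (intro fermat_theorem) blast+
  hence "[int (b ^ (nat p - 1)) = int 1] (mod int (nat p))"
    by (simp only: cong_int_iff)
  hence "[(a mod p) ^ (nat p - 1) = 1] (mod p)"
    using p by (simp add: b)
  thus ?thesis by (simp add: cong_def power_mod)
qed

text \<open>
  Half of the first supplement to quadratic reciprocity. Modulo \<open>p\<close>, raise \<open>y\<^sup>2 = -k\<^sup>2\<close> to the
  power \<open>(p - 1) / 2\<close>. If \<open>p\<close> were \<open>3\<close> modulo \<open>4\<close>, this exponent would be odd, and Fermat's little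
  theorem would turn the result into \<open>1 = -1\<close>.
\<close>

lemma prime_divisor_sum_of_squares_cong_1_mod_4:
  fixes p y k :: int
  assumes p: "prime p" "odd p" and dvd: "p dvd y\<^sup>2 + k\<^sup>2" and k: "\<not> p dvd k"
  shows "[p = 1] (mod 4)"
proof (rule ccontr)
  assume contra: "[p \<noteq> 1] (mod 4)"
  have "p > 1" using p(1) by (simp add: prime_gt_1_int)
  have "p mod 4 = 3" using contra \<open>odd p\<close> unfolding cong_def by presburger
  then obtain t where t: "p = 4 * t + 3" by (metis mult_div_mod_eq)
  define m where "m = nat (2 * t + 1)"
  have "t \<ge> 0" using t \<open>p > 1\<close> by linarith
  hence m: "nat p - 1 = 2 * m" "odd m"
    by (auto simp: m_def t even_nat_iff)
  have y: "\<not> p dvd y"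
  proof
    assume "p dvd y"
    hence "p dvd k\<^sup>2" using dvd by (simp add: power2_eq_square dvd_add_right_iff)
    thus False using k p(1) prime_dvd_power_int by blast
  qed
  have "[y\<^sup>2 = - (k\<^sup>2)] (mod p)" using dvd by (simp add: cong_iff_dvd_diff)
  hence "[(y\<^sup>2) ^ m = (- (k\<^sup>2)) ^ m] (mod p)" by (rule cong_pow)
  hence "[y ^ (2 * m) = - (k ^ (2 * m))] (mod p)"
    using m(2) by (simp add: power_mult)
  moreover have "[y ^ (2 * m) = 1] (mod p)" "[k ^ (2 * m) = 1] (mod p)"
    using fermat_theorem_int[OF p(1) y] fermat_theorem_int[OF p(1) k] m(1) by simp_all
  ultimately have "[1 = - (1::int)] (mod p)"
    by (meson cong_minus_minus_iff cong_sym cong_trans)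
  hence "p dvd 2" by (simp add: cong_iff_dvd_diff)
  hence "p \<le> 2" by (rule zdvd_imp_le) simp
  thus False using \<open>p > 1\<close> \<open>odd p\<close> by (cases "p = 2") auto
qed

lemma cong_1_if_prime_divisors_cong_1:
  fixes d m :: int
  assumes "d > 0" and "\<And>p. prime p \<Longrightarrow> p dvd d \<Longrightarrow> [p = 1] (mod m)"
  shows "[d = 1] (mod m)"
  using assms
proof (induction d rule: prime_divisors_induct)
  case (factor p d)
  have "d > 0"
    using zero_less_mult_pos[OF factor.prems(1) prime_gt_0_int[OF factor.hyps]] .
  hence "[d = 1] (mod m)" using factor.IH factor.prems(2) by simp
  moreover have "[p = 1] (mod m)" using factor.prems(2) factor.hyps by simp
  ultimately show ?case using cong_mult by fastforce
qed auto

lemma odd_divisor_cong_1_mod_4: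
  fixes M k y d :: int
  assumes M: "\<And>p. prime p \<Longrightarrow> p dvd M \<Longrightarrow> [p = 1] (mod 4)"
    and k: "\<And>p. prime p \<Longrightarrow> p dvd k \<Longrightarrow> [p = 1] (mod 4)"
    and d: "d > 0" "odd d" "d dvd M * (y\<^sup>2 + k\<^sup>2)"
  shows "[d = 1] (mod 4)"
proof (rule cong_1_if_prime_divisors_cong_1[OF d(1)])
  fix p :: int
  assume p: "prime p" "p dvd d"
  have "odd p" using p(2) d(2) dvd_trans by blast
  have "p dvd M \<or> p dvd y\<^sup>2 + k\<^sup>2"
    using p d(3) by (meson dvd_trans prime_dvd_multD)
  thus "[p = 1] (mod 4)"
    using M[OF p(1)] k[OF p(1)] \<open>odd p\<close> p(1) prime_divisor_sum_of_squares_cong_1_mod_4 by blast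
qed

section \<open>The obstruction modulo 4\<close>

lemma poly_cong_int:
  fixes f :: "int poly"
  assumes "[x = y] (mod m)"
  shows "[poly f x = poly f y] (mod m)"
  by (induction f) (simp_all add: assms cong_add cong_mult)

lemma odd_square_cong_1_mod_4:
  fixes z :: int
  assumes "odd z"
  shows "[z\<^sup>2 = 1] (mod 4)"
proof -
  obtain t where "z = 2 * t + 1" using assms by (elim oddE)
  hence "z\<^sup>2 - 1 = 4 * (t * (t + 1))" by (simp add: power2_eq_square algebra_simps)
  thus ?thesis by (simp add: cong_iff_dvd_diff)
qed

text \<open>
  The last two congruences are the values of \<open>f(0)\<close> and of twice the sum of the odd coefficients.
  Each of them excludes the points with one parity of \<open>x\<close>: the first even, the second odd \<open>x\<close>. The
  second one is taken modulo \<open>8\<close> because it is halved in the proof.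
\<close>

lemma no_point_if_congruences:
  fixes f :: "int poly" and M k x y :: int
  assumes M: "M > 0" "odd M" "\<And>p. prime p \<Longrightarrow> p dvd M \<Longrightarrow> [p = 1] (mod 4)"
    and k: "odd k" "\<And>p. prime p \<Longrightarrow> p dvd k \<Longrightarrow> [p = 1] (mod 4)"
    and f_minus_1: "poly f (-1) = - (M * k\<^sup>2)"
    and f_0: "[poly f 0 = 2] (mod 4)"
    and f_1: "[poly f 1 - poly f (-1) = 6] (mod 8)"
    and x: "x > 0"
  shows "M * y\<^sup>2 \<noteq> poly f x"
proof
  assume point: "M * y\<^sup>2 = poly f x"
  define h where "h = synthetic_div f (-1)"
  have h: "poly f z - poly f (-1) = (z + 1) * poly h z" for z
  proof -
    have "f = [:1, 1:] * h + [:poly f (-1):]"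
      using synthetic_div_correct'[of "-1" f] by (simp add: h_def)
    hence "poly f z = poly ([:1, 1:] * h + [:poly f (-1):]) z"
      by (rule arg_cong[where f = "\<lambda>g. poly g z"])
    thus ?thesis by (simp add: algebra_simps)
  qed
  have factor: "M * (y\<^sup>2 + k\<^sup>2) = (x + 1) * poly h x"
    using h[of x] point f_minus_1 by (simp add: algebra_simps)
  note div_cong = odd_divisor_cong_1_mod_4[OF M(3) k(2), where y = y]
  have M_mod: "[M = 1] (mod 4)"
    by (rule cong_1_if_prime_divisors_cong_1[OF M(1,3)])
  show False
  proof (cases "even x")
    case True
    have "[x + 1 = 1] (mod 4)"
      using x True by (intro div_cong) (auto simp: factor)
    hence "[x = 0] (mod 4)" by (simp add: cong_iff_dvd_diff)
    hence "[M * y\<^sup>2 = 2] (mod 4)"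
      using poly_cong_int[of x 0 4 f] f_0 cong_trans unfolding point by blast
    moreover have "[M * y\<^sup>2 = 1 * y\<^sup>2] (mod 4)"
      using M_mod by (intro cong_mult) simp_all
    ultimately have y2: "[y\<^sup>2 = 2] (mod 4)"
      by (metis cong_sym cong_trans mult_1)
    have "even y"
    proof (rule ccontr)
      assume "odd y"
      hence "[y\<^sup>2 = 1] (mod 4)" by (rule odd_square_cong_1_mod_4)
      thus False using y2 by (simp add: cong_def)
    qed
    then obtain t where "y = 2 * t" by (elim evenE)
    hence "y\<^sup>2 = 4 * t\<^sup>2" by simp
    thus False using y2 by (simp add: cong_def)
  next
    case False
    have "[x = -1] (mod 2)" using False by (simp add: cong_iff_dvd_diff)
    hence "[M * y\<^sup>2 = - (M * k\<^sup>2)] (mod 2)"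
      using poly_cong_int[of x "-1" 2 f] unfolding point f_minus_1 by simp
    hence "even (M * y\<^sup>2 + M * k\<^sup>2)" by (simp add: cong_iff_dvd_diff)
    hence y: "odd y" using M(2) k(1) by simp
    have "[M * (y\<^sup>2 + k\<^sup>2) = 1 * (1 + 1)] (mod 4)"
      by (intro cong_mult cong_add M_mod odd_square_cong_1_mod_4 y k(1))
    hence two: "((x + 1) * poly h x) mod 4 = 2" by (simp add: factor cong_def)
    have "even (x + 1)" using False by simp
    then obtain u where u: "x + 1 = 2 * u" by (elim evenE)
    have "(2 * (u * poly h x)) mod 4 = 2" using two by (simp add: u mult.assoc)
    moreover have "odd w" if "(2 * w) mod 4 = 2" for w :: int using that by presburger
    ultimately have "odd (u * poly h x)" by blast
    hence odd: "odd u" "odd (poly h x)" by auto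
    have "y\<^sup>2 + k\<^sup>2 > 0" using k(1) by (auto simp: sum_power2_gt_zero_iff)
    hence "(x + 1) * poly h x > 0" using M(1) by (simp flip: factor)
    hence "poly h x > 0" using x by (simp add: zero_less_mult_iff)
    hence hx: "[poly h x = 1] (mod 4)"
      using odd by (intro div_cong) (auto simp: factor)
    have "[x = 1] (mod 4)" using u odd(1) unfolding cong_def by presburger
    hence "[poly h x = poly h 1] (mod 4)" by (rule poly_cong_int)
    hence "poly h 1 mod 4 = 1" using hx by (simp add: cong_def)
    moreover have "(2 * poly h 1) mod 8 = 6" using f_1 h[of 1] by (simp add: cong_def)
    moreover have "(2 * w) mod 8 = 2" if "w mod 4 = 1" for w :: int using that by presburger
    ultimately show False by fastforce
  qed
qed

section \<open>The linear system as conditions on the polynomial\<close>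

text \<open>
  Twice the weight \<open>(-1)\<^sup>i i (i - 2)\<close> of the first equation agrees modulo \<open>8\<close> with
  \<open>1 - (-1)\<^sup>i\<close>, the weight of the \<open>i\<close>-th coefficient in \<open>f(1) - f(-1)\<close>.
\<close>

lemma weight_cong_mod_8:
  fixes i :: nat
  shows "[2 * ((-1) ^ i * (int i * (int i - 2))) = 1 - (-1) ^ i] (mod 8)"
proof (cases "even i")
  case True
  then obtain t where "i = 2 * t" by (elim evenE)
  hence "2 * ((-1) ^ i * (int i * (int i - 2))) - (1 - (-1) ^ i) = 8 * (int t * (int t - 1))"
    by (simp add: algebra_simps)
  thus ?thesis by (simp add: cong_iff_dvd_diff)
next
  case False
  then obtain t where "i = 2 * t + 1" by (elim oddE)
  hence "2 * ((-1) ^ i * (int i * (int i - 2))) - (1 - (-1) ^ i) = 8 * (- (int t)\<^sup>2)"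
    by (simp add: power2_eq_square algebra_simps)
  thus ?thesis by (simp add: cong_iff_dvd_diff)
qed

definition curve_poly :: "nat \<Rightarrow> (nat \<Rightarrow> nat \<Rightarrow> int) \<Rightarrow> (nat \<Rightarrow> int) \<Rightarrow> int poly" where
  "curve_poly n a c = (\<Sum>j=0..n. Polynomial.monom (a 3 (j+1) * c (j+1)) (n-j))"

lemma poly_curve_poly:
  "poly (curve_poly n a c) x = (\<Sum>j=0..n. a 3 (j+1) * c (j+1) * x ^ (n-j))"
  by (simp add: curve_poly_def poly_sum poly_monom)

lemma solution_poly_minus_1:
  assumes "c \<in> solutions n M k U D a"
  shows "poly (curve_poly n a c) (-1) = - (M * k\<^sup>2)"
proof -
  have "M * k\<^sup>2 = (\<Sum>j=0..n. (-1) ^ (n-j+1) * a 3 (j+1) * c (j+1))"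
    using assms by (simp add: solutions_def)
  thus ?thesis by (simp add: poly_curve_poly sum_negf algebra_simps)
qed

lemma solution_poly_0:
  assumes "n > 0" and "\<And>j. j \<in> {1..n+1} \<Longrightarrow> a 2 j = a 3 j"
    and "c \<in> solutions n M k U D a"
  shows "poly (curve_poly n a c) 0 = 4 * D - 1 - M * k\<^sup>2"
proof -
  obtain m where m: "n = Suc m" using assms(1) gr0_implies_Suc by blast
  let ?b = "\<lambda>j. a 3 (j+1) * c (j+1)"
  have "4 * D - 1 = (\<Sum>j=0..m. (-1) ^ (n-j+1) * a 2 (j+1) * c (j+1))"
    using assms(3) by (simp add: solutions_def m)
  also have "\<dots> = (\<Sum>j=0..m. (-1) ^ (n-j+1) * ?b j)"
    by (intro sum.cong) (auto simp: assms(2) m)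
  also have "\<dots> = (\<Sum>j=0..n. (-1) ^ (n-j+1) * ?b j) + ?b n" by (simp add: m)
  also have "(\<Sum>j=0..n. (-1) ^ (n-j+1) * ?b j) = M * k\<^sup>2"
    using assms(3) by (simp add: solutions_def mult.assoc)
  also have "?b n = poly (curve_poly n a c) 0"
    by (simp add: poly_curve_poly m power_0_left Suc_diff_le)
  finally show ?thesis by simp
qed

lemma solution_poly_1:
  assumes "n \<ge> 2" and "\<And>j. j \<in> {1..n+1} \<Longrightarrow> a 1 j = a 3 j"
    and "c \<in> solutions n M k U D a"
  shows "[poly (curve_poly n a c) 1 - poly (curve_poly n a c) (-1) = 6] (mod 8)"
proof -
  obtain m where m: "n = m + 2" using assms(1) by (metis le_add_diff_inverse2)
  let ?b = "\<lambda>j. a 3 (j+1) * c (j+1)"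
  let ?w = "\<lambda>i. (-1) ^ i * (int i * (int i - 2))"
  \<comment> \<open>The first equation omits \<open>i = 2\<close> and \<open>i = 0\<close>, whose weights vanish,
    and it treats \<open>i = 1\<close> apart, whose weight is \<open>1\<close>.\<close>
  have "4 * U - 1 = (\<Sum>j<m. (-1) ^ (m-j) * a 1 (j+1) * eps n j * c (j+1)) + a 1 n * c n"
    using assms(3) by (simp add: solutions_def m)
  also have "(\<Sum>j<m. (-1) ^ (m-j) * a 1 (j+1) * eps n j * c (j+1)) = (\<Sum>j<m. ?b j * ?w (n-j))"
  proof (intro sum.cong refl)
    fix j assume "j \<in> {..<m}"
    hence "n - j = m - j + 2" "int (n - j) = int n - int j" "a 1 (j+1) = a 3 (j+1)"
      using assms(2)[of "j+1"] by (auto simp: m)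
    thus "(-1) ^ (m-j) * a 1 (j+1) * eps n j * c (j+1) = ?b j * ?w (n-j)"
      by (simp add: eps_def power_add mult_ac)
  qed
  also have "a 1 n * c n = ?b (m + 1)" using assms(2)[of n] by (simp add: m)
  also have "(\<Sum>j<m. ?b j * ?w (n-j)) + ?b (m + 1) = (\<Sum>j=0..n. ?b j * ?w (n-j))"
    by (simp add: m atLeast0AtMost flip: lessThan_Suc_atMost)
  finally have "2 * (4 * U - 1) = (\<Sum>j=0..n. ?b j * (2 * ?w (n-j)))"
    by (simp add: sum_distrib_left mult_ac)
  moreover have "[(\<Sum>j=0..n. ?b j * (2 * ?w (n-j))) = (\<Sum>j=0..n. ?b j * (1 - (-1) ^ (n-j)))] (mod 8)"
    by (intro cong_sum cong_mult weight_cong_mod_8 cong_refl)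
  moreover have "(\<Sum>j=0..n. ?b j * (1 - (-1) ^ (n-j)))
      = poly (curve_poly n a c) 1 - poly (curve_poly n a c) (-1)"
    by (simp add: poly_curve_poly right_diff_distrib sum_subtractf)
  moreover have "[2 * (4 * U - 1) = 6] (mod 8)" by (simp add: cong_iff_dvd_diff)
  ultimately show ?thesis by (metis cong_sym cong_trans)
qed

theorem theorem4p1:
  fixes n :: nat and M k U D :: int and a :: "nat \<Rightarrow> nat \<Rightarrow> int"
  assumes "n \<ge> 2"
    and "M \<ge> 1" and "odd M" and "\<And>p::int. prime p \<Longrightarrow> p dvd M \<Longrightarrow> [p = 1] (mod 4)"
    and "k \<ge> 1" and "odd k" and "\<And>p::int. prime p \<Longrightarrow> p dvd k \<Longrightarrow> [p = 1] (mod 4)"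
    and "U \<ge> 0" and "D \<ge> 0"
    and "\<And>j. j \<in> {1..n+1} \<Longrightarrow> a 1 j = a 2 j \<and> a 2 j = a 3 j"
    and "\<forall>s \<in> solutions n M k U D a. \<exists>g. nonsingular_plane_curve (curve n M a s) g n"
    and "\<forall>s \<in> solutions n M k U D a. \<forall>(x, y) \<in> positive_points (curve n M a s). x > 1 \<and> y \<ge> 1"
  shows "\<forall>s \<in> solutions n M k U D a. positive_points (curve n M a s) = {}"
proof
  fix s
  assume s: "s \<in> solutions n M k U D a"
  let ?f = "curve_poly n a s"
  have "[M = 1] (mod 4)"
    using assms(2) by (intro cong_1_if_prime_divisors_cong_1[OF _ assms(4)]) auto
  moreover have "[k\<^sup>2 = 1] (mod 4)"
    using assms(6) by (rule odd_square_cong_1_mod_4)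
  ultimately have "[M * k\<^sup>2 = 1 * 1] (mod 4)" by (rule cong_mult)
  moreover have "[4 * D - 1 = 3] (mod 4)" by (simp add: cong_iff_dvd_diff)
  ultimately have "[4 * D - 1 - M * k\<^sup>2 = 3 - 1 * 1] (mod 4)" by (intro cong_diff)
  hence "[4 * D - 1 - M * k\<^sup>2 = 2] (mod 4)" by simp
  hence f_0: "[poly ?f 0 = 2] (mod 4)"
    using assms(1,10) s by (subst solution_poly_0) auto
  have f_1: "[poly ?f 1 - poly ?f (-1) = 6] (mod 8)"
    using assms(1,10) s by (intro solution_poly_1) auto
  have "M * y\<^sup>2 \<noteq> poly ?f x" if "x > 0" for x y
    using assms(2) that
    by (intro no_point_if_congruences[OF _ assms(3,4,6,7) solution_poly_minus_1[OF s] f_0 f_1]) auto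
  thus "positive_points (curve n M a s) = {}"
    by (auto simp: positive_points_def eval2_curve poly_curve_poly)
qed

end
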